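(* Let $l\geq 1$ be an integer, $\lambda\in\mathbb{R}$ and $\mu>0$. If the equation $$z^2E''+\big((-l+1)z+\mu(1-z^2)\big)E'+\big(\mu(l-1)z+\lambda\big)E=0$$ has a polynomial solution $E$ that is not identically zero, then the equation $$z^2E''+\big((l+1)z+\mu(1-z^2)\big)E'+\big(\lambda-\mu(l+1)z\big)E=0$$ has no entire solution other than the identically zero one.
   Context: Both equations are linear ordinary differential equations for a function $E=E(z)$ of the complex variable $z$; primes denote $d/dz$. An entire solution is a solution holomorphic on all of $\mathbb{C}$. *)

theory Defs
  imports "HOL-Complex_Analysis.Complex_Analysis" "HOL-Computational_Algebra.Polynomial"
begin

text \<open>
  Two double confluent Heun equations, which correspond to each other under the sign change of l.
  The coefficient of the second derivative vanishes at the origin; the equations are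
  nevertheless required to hold there as well, as for any solution holomorphic on all of the plane.
\<close>

definition heun_eq_neg :: "int \<Rightarrow> real \<Rightarrow> real \<Rightarrow> (complex \<Rightarrow> complex) \<Rightarrow> bool" where
  "heun_eq_neg l lam \<mu> E \<longleftrightarrow>
     (\<forall>z. z\<^sup>2 * deriv (deriv E) z
        + ((- of_int l + 1) * z + of_real \<mu> * (1 - z\<^sup>2)) * deriv E z
        + (of_real \<mu> * (of_int l - 1) * z + of_real lam) * E z = 0)"

definition heun_eq_pos :: "int \<Rightarrow> real \<Rightarrow> real \<Rightarrow> (complex \<Rightarrow> complex) \<Rightarrow> bool" where
  "heun_eq_pos l lam \<mu> E \<longleftrightarrow>
     (\<forall>z. z\<^sup>2 * deriv (deriv E) z
        + ((of_int l + 1) * z + of_real \<mu> * (1 - z\<^sup>2)) * deriv E z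
        + (of_real lam - of_real \<mu> * (of_int l + 1) * z) * E z = 0)"

end

theory Submission
  imports Defs
begin

text \<open>
  The equation with \<open>-l\<close> in place of \<open>l\<close> is the other equation, and if \<open>P\<close> solves the former,
  then \<open>u(z) = exp (\<mu> (z + 1/z)) P(-1/z)\<close> solves the latter on the punctured plane. For a
  polynomial \<open>P\<close>, which must have degree \<open>l - 1\<close>, the Laurent coefficients of \<open>u\<close> are finite
  combinations \<open>u\<^sub>k = (\<Sum>j<l. q\<^sub>j I\<^bsub>k+j\<^esub>)\<close> of values \<open>I\<^sub>n = I\<^sub>n(2\<mu>)\<close> of modified Bessel functions,
  where \<open>q\<^sub>j = (-1)\<^sup>j p\<^sub>j\<close>. On the level of coefficients, both equations are three-term recurrences,
  and the three-term recurrence of the Bessel functions suffices to see that \<open>u\<close> satisfies its own.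

  Suppose that there is a nonzero entire solution, with Taylor coefficients \<open>e\<^sub>n\<close>. Both \<open>e\<close> and \<open>u\<close>
  solve the recurrence and tend to zero as \<open>n\<close> goes to infinity. Their Casoratian cannot decrease
  in modulus as \<open>n\<close> grows, so it vanishes, and then \<open>u\<close>, like \<open>e\<close>, has a zero
  at the index \<open>-1\<close>. Running the recurrence downwards gives \<open>u\<^sub>k = 0\<close> for \<open>-l \<le> k \<le> -1\<close>.

  These \<open>l\<close> linear equations for the \<open>l\<close> numbers \<open>q\<^sub>j\<close> have only the trivial solution, by a
  positivity argument. Put \<open>a\<^sub>n = \<mu>\<^sup>n / n!\<close> for \<open>n \<ge> 0\<close> and \<open>a\<^sub>n = 0\<close> for \<open>n < 0\<close>. Then
  \<open>I\<^bsub>j-k\<^esub> = (\<Sum>m. a\<^bsub>m-j\<^esub> a\<^bsub>m-k\<^esub>)\<close> is a Gram matrix, so the equations say that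
  \<open>A\<^sub>m = (\<Sum>j<l. q\<^sub>j a\<^bsub>m-j\<^esub>)\<close>, as a function of \<open>m\<close>, is orthogonal to \<open>a\<^bsub>m-k\<^esub>\<close> for \<open>1 \<le> k \<le> l\<close>.
  Since \<open>m a\<^bsub>m-j\<^esub> = \<mu> a\<^bsub>m-j-1\<^esub> + j a\<^bsub>m-j\<^esub>\<close>, the function \<open>m A\<^sub>m\<close> is a combination
  of exactly these, whence \<open>(\<Sum>m. m \<bar>A\<^sub>m\<bar>\<^sup>2) = 0\<close>. So \<open>A\<^sub>m = 0\<close> for all \<open>m \<ge> 1\<close>; as the \<open>A\<^sub>m\<close> are the
  Taylor coefficients of \<open>exp (\<mu> z) (\<Sum>j<l. q\<^sub>j z\<^sup>j)\<close>, all \<open>q\<^sub>j\<close> vanish, which contradicts \<open>P \<noteq> 0\<close>.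
\<close>

section \<open>Coefficients of the exponential function\<close>

text \<open>
  Indexing by integers, with value zero at negative indices, makes the recurrence below hold
  without exception and removes all bounds from the sums that follow.
\<close>

definition exp_coeff :: "real \<Rightarrow> int \<Rightarrow> real" where
  "exp_coeff x n = (if n < 0 then 0 else x ^ nat n / fact (nat n))"

lemma exp_coeff_rec: "of_int n * exp_coeff x n = x * exp_coeff x (n - 1)"
proof (cases "n \<ge> 1")
  case True
  define k where "k = nat (n - 1)"
  have n: "n = int k + 1" using True by (simp add: k_def)
  then have "exp_coeff x n = x * x ^ k / ((real k + 1) * fact k)"
    by (simp add: exp_coeff_def nat_add_distrib algebra_simps)
  moreover have "exp_coeff x (n - 1) = x ^ k / fact k"
    using n by (simp add: exp_coeff_def)
  ultimately show ?thesis using n by simp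
qed (auto simp: exp_coeff_def)

lemma exp_coeff_nonneg: "x \<ge> 0 \<Longrightarrow> exp_coeff x n \<ge> 0"
  by (simp add: exp_coeff_def)

lemma exp_coeff_neg [simp]: "n < 0 \<Longrightarrow> exp_coeff x n = 0"
  by (simp add: exp_coeff_def)

lemma exp_coeff_of_nat: "exp_coeff x (int n) = x ^ n / fact n"
  by (simp add: exp_coeff_def)

lemma sums_exp_coeff: "(\<lambda>m. exp_coeff x (int m)) sums exp x"
  using exp_converges[of x] by (simp add: exp_coeff_of_nat divide_inverse mult.commute)

lemma exp_coeff_le_exp:
  assumes "x \<ge> 0"
  shows "exp_coeff x n \<le> exp x"
proof (cases "n < 0")
  case False
  then obtain m where m: "n = int m" by (metis nonneg_int_cases not_less)
  have "sum (\<lambda>m. exp_coeff x (int m)) {m} \<le> (\<Sum>m. exp_coeff x (int m))"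
    using sums_exp_coeff[of x] assms
    by (intro sum_le_suminf) (auto simp: sums_iff exp_coeff_nonneg)
  then show ?thesis using sums_exp_coeff[of x] m by (simp add: sums_iff)
qed (auto simp: exp_coeff_def)

lemma summable_exp_coeff_mult:
  assumes "x \<ge> 0"
  shows "summable (\<lambda>m. exp_coeff x (int m) * exp_coeff x (int m + k))"
proof (rule summable_comparison_test)
  show "summable (\<lambda>m. exp_coeff x (int m) * exp x)"
    using sums_exp_coeff[of x] by (intro summable_mult2) (auto simp: sums_iff)
  show "\<exists>N. \<forall>m\<ge>N. norm (exp_coeff x (int m) * exp_coeff x (int m + k)) \<le> exp_coeff x (int m) * exp x"
    using assms by (auto intro!: mult_left_mono exp_coeff_le_exp simp: exp_coeff_nonneg abs_mult)
qed

section \<open>Modified Bessel functions of integer order\<close>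

text \<open>
  In the usual notation this is the value \<open>I\<^sub>k(2x)\<close>, that is, the coefficient of \<open>z\<^sup>k\<close>
  in \<open>exp (x (z + 1/z))\<close>.
\<close>

definition bessel_I :: "real \<Rightarrow> int \<Rightarrow> real" where
  "bessel_I x k = (\<Sum>m. exp_coeff x (int m) * exp_coeff x (int m + k))"

lemma bessel_I_sums:
  "x \<ge> 0 \<Longrightarrow> (\<lambda>m. exp_coeff x (int m) * exp_coeff x (int m + k)) sums bessel_I x k"
  unfolding bessel_I_def by (intro summable_sums summable_exp_coeff_mult)

text \<open>
  This exhibits \<open>I\<^bsub>j-i\<^esub>\<close> as an inner product of two shifts of the sequence of coefficients of the
  exponential function, which is the source of positivity.
\<close>

lemma bessel_I_sums_shifted:
  assumes "x \<ge> 0"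
  shows "(\<lambda>m. exp_coeff x (int m - int j) * exp_coeff x (int m - i)) sums bessel_I x (int j - i)"
proof -
  have "(\<lambda>m. exp_coeff x (int (m + j) - int j) * exp_coeff x (int (m + j) - i))
          sums bessel_I x (int j - i)"
    using bessel_I_sums[OF assms, of "int j - i"] by (simp add: algebra_simps)
  then show ?thesis
    by (subst (asm) sums_zero_iff_shift) auto
qed

text \<open>
  Split \<open>k = (m + k) - m\<close> in the defining series and absorb each factor into the factorial
  that belongs to it.
\<close>

lemma bessel_I_rec:
  assumes "x \<ge> 0"
  shows "of_int k * bessel_I x k = x * (bessel_I x (k - 1) - bessel_I x (k + 1))"
proof -
  let ?a = "exp_coeff x"
  have 1: "(\<lambda>m. x * (?a (int m) * ?a (int m + k - 1))) sums (x * bessel_I x (k - 1))"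
    using bessel_I_sums[OF assms, of "k - 1"] by (intro sums_mult) (simp add: algebra_simps)
  have 2: "(\<lambda>m. x * (?a (int m - 1) * ?a (int m + k))) sums (x * bessel_I x (k + 1))"
    using bessel_I_sums_shifted[OF assms, of 1 "- k"] by (intro sums_mult) (simp add: algebra_simps)
  have "x * (?a (int m) * ?a (int m + k - 1)) - x * (?a (int m - 1) * ?a (int m + k))
          = of_int k * (?a (int m) * ?a (int m + k))" for m
  proof -
    have "(of_nat m + of_int k) * ?a (int m + k) = x * ?a (int m + k - 1)"
      "of_nat m * ?a (int m) = x * ?a (int m - 1)"
      using exp_coeff_rec[of "int m + k" x] exp_coeff_rec[of "int m" x] by simp_all
    then show ?thesis by algebra
  qed
  with sums_diff[OF 1 2] have "(\<lambda>m. of_int k * (?a (int m) * ?a (int m + k)))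
      sums (x * bessel_I x (k - 1) - x * bessel_I x (k + 1))"
    by simp
  then show ?thesis
    using sums_mult[OF bessel_I_sums[OF assms, of k], of "of_int k"]
    by (simp add: sums_iff algebra_simps)
qed

text \<open>From \<open>m! n! \<le> (m + n)!\<close> one gets \<open>I\<^sub>n \<le> I\<^sub>0 x\<^sup>n / n!\<close>.\<close>

lemma bessel_I_tendsto_0:
  assumes "x \<ge> 0"
  shows "(\<lambda>n. bessel_I x (int n + int j)) \<longlonglongrightarrow> 0"
proof -
  have le: "0 \<le> bessel_I x (int n) \<and> bessel_I x (int n) \<le> exp_coeff x (int n) * bessel_I x 0" for n
  proof
    show "0 \<le> bessel_I x (int n)" unfolding bessel_I_def
      by (intro suminf_nonneg summable_exp_coeff_mult mult_nonneg_nonneg exp_coeff_nonneg assms)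
    have "exp_coeff x (int m) * exp_coeff x (int m + int n)
        \<le> exp_coeff x (int n) * (exp_coeff x (int m) * exp_coeff x (int m + 0))" for m
    proof -
      have "(fact m * fact n :: real) \<le> fact (m + n)"
        by (metis fact_fact_dvd_fact dvd_imp_le fact_gt_zero of_nat_fact of_nat_le_iff of_nat_mult)
      then have "x ^ (m + n) / fact (m + n) \<le> x ^ (m + n) / (fact m * fact n)"
        using assms by (intro divide_left_mono) auto
      then have "exp_coeff x (int m + int n) \<le> exp_coeff x (int n) * exp_coeff x (int m)"
        unfolding of_nat_add[symmetric] exp_coeff_of_nat by (simp add: power_add mult_ac)
      from mult_left_mono[OF this exp_coeff_nonneg[OF assms, of "int m"]] show ?thesis
        by (simp add: mult_ac)
    qed
    then show "bessel_I x (int n) \<le> exp_coeff x (int n) * bessel_I x 0"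
      by (intro sums_le[OF _ bessel_I_sums[OF assms] sums_mult[OF bessel_I_sums[OF assms]]]) 
  qed
  have "(\<lambda>n. exp_coeff x (int n) * bessel_I x 0) \<longlonglongrightarrow> 0"
    using sums_exp_coeff[of x] by (intro tendsto_mult_left_zero summable_LIMSEQ_zero) (auto simp: sums_iff)
  from real_tendsto_sandwich[OF _ _ tendsto_const[of 0] this, of "\<lambda>n. bessel_I x (int n)"]
  have lim: "(\<lambda>n. bessel_I x (int n)) \<longlonglongrightarrow> 0"
    using le by simp
  show ?thesis
    using LIMSEQ_ignore_initial_segment[OF lim, of j] by simp
qed

text \<open>
  The determinant of the Toeplitz matrix with entries \<open>I\<^bsub>j-k\<^esub>\<close>, \<open>0 \<le> j \<le> d\<close> and \<open>1 \<le> k \<le> d + 1\<close>, does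
  not vanish. The two index ranges differ by a shift, so this is no Gram determinant; but passing from
  \<open>A\<^sub>m\<close> to \<open>m A\<^sub>m\<close> turns the first range into the second, and so the weight \<open>m\<close> restores positivity.
\<close>

lemma bessel_I_toeplitz_kernel_trivial:
  fixes q :: "nat \<Rightarrow> complex"
  assumes x: "x > 0" and supp: "\<And>j. j > d \<Longrightarrow> q j = 0"
    and orth: "\<And>k. k \<in> {1..Suc d} \<Longrightarrow> (\<Sum>j\<le>d. q j * of_real (bessel_I x (int j - int k))) = 0"
  shows "q j = 0"
proof -
  define a where "a m k = complex_of_real (exp_coeff x (int m - int k))" for m k
  define A where "A m = (\<Sum>j\<le>d. q j * a m j)" for m
  define U where "U k = (\<Sum>j\<le>d. q j * of_real (bessel_I x (int j - int k)))" for k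
  have sumsU: "(\<lambda>m. a m k * A m) sums U k" for k
  proof -
    have "(\<lambda>m. \<Sum>j\<le>d. q j * (a m j * a m k)) sums U k"
      unfolding U_def a_def of_real_mult[symmetric]
      using x by (intro sums_sum sums_mult sums_of_real bessel_I_sums_shifted) auto
    then show ?thesis by (simp add: A_def sum_distrib_left mult_ac)
  qed
  have arec: "of_nat m * a m j = of_real x * a m (Suc j) + of_nat j * a m j" for m j
    using arg_cong[OF exp_coeff_rec[of "int m - int j" x], of complex_of_real]
    by (simp add: a_def algebra_simps)
  have "(\<lambda>m. \<Sum>j\<le>d. cnj (q j) * (of_real x * (a m (Suc j) * A m) + of_nat j * (a m j * A m)))
          sums (\<Sum>j\<le>d. cnj (q j) * (of_real x * U (Suc j) + of_nat j * U j))"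
    by (intro sums_sum sums_mult sums_add sumsU)
  moreover have "of_real x * U (Suc j) + of_nat j * U j = 0" if "j \<le> d" for j
    using orth[of "Suc j"] orth[of j] that by (cases "j = 0") (auto simp: U_def)
  moreover have "(\<Sum>j\<le>d. cnj (q j) * (of_real x * (a m (Suc j) * A m) + of_nat j * (a m j * A m)))
      = of_real (of_nat m * (norm (A m))\<^sup>2)" for m
  proof -
    have "(\<Sum>j\<le>d. cnj (q j) * (of_real x * (a m (Suc j) * A m) + of_nat j * (a m j * A m)))
        = (\<Sum>j\<le>d. cnj (q j) * (of_nat m * a m j * A m))"
      by (simp add: arec algebra_simps)
    also have "\<dots> = of_nat m * (cnj (A m) * A m)"
      unfolding A_def cnj_sum complex_cnj_mult
      by (simp add: sum_distrib_left sum_distrib_right mult_ac a_def)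
    also have "cnj (A m) * A m = of_real ((norm (A m))\<^sup>2)"
      by (simp add: complex_norm_square mult.commute del: of_real_power)
    finally show ?thesis by simp
  qed
  ultimately have "(\<lambda>m. complex_of_real (of_nat m * (norm (A m))\<^sup>2)) sums of_real 0"
    by simp
  then have "(\<lambda>m. of_nat m * (norm (A m))\<^sup>2) sums 0"
    by (subst (asm) sums_of_real_iff)
  then have "of_nat m * (norm (A m))\<^sup>2 = 0" for m
    using suminf_eq_zero_iff[of "\<lambda>m. of_nat m * (norm (A m))\<^sup>2"] by (auto simp: sums_iff)
  then have A0: "A m = 0" if "m > 0" for m
    using that by (metis mult_eq_0_iff norm_eq_zero not_gr_zero of_nat_eq_0_iff power_eq_0_iff)
  \<comment> \<open>The polynomial with coefficients \<open>q\<close> is thus a constant multiple of \<open>exp (- x z)\<close>, whose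
    coefficients never vanish.\<close>
  let ?Q = "Abs_fps q"
  have "fps_nth (?Q * fps_exp (of_real x)) m = A m" for m
  proof -
    have "fps_nth (?Q * fps_exp (of_real x)) m = (\<Sum>j\<le>m. q j * a m j)"
      unfolding fps_mult_nth atLeast0AtMost
      by (intro sum.cong) (auto simp: a_def exp_coeff_def nat_diff_distrib)
    also have "\<dots> = (\<Sum>j\<le>max m d. q j * a m j)"
      by (intro sum.mono_neutral_left) (auto simp: a_def)
    also have "\<dots> = A m"
      unfolding A_def by (intro sum.mono_neutral_right) (auto simp: supp)
    finally show ?thesis .
  qed
  then have "?Q * fps_exp (of_real x) = fps_const (A 0)"
    using A0 by (intro fps_ext) auto
  then have "?Q * (fps_exp (of_real x) * fps_exp (- of_real x)) = fps_const (A 0) * fps_exp (- of_real x)"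
    by (metis mult.assoc)
  then have Q: "?Q = fps_const (A 0) * fps_exp (- of_real x)"
    by (simp add: fps_exp_add_mult[symmetric])
  have "A 0 = 0"
    using arg_cong[OF Q, of "\<lambda>F. fps_nth F (Suc d)"] supp[of "Suc d"] x by (simp del: fact_Suc)
  then show "q j = 0"
    using arg_cong[OF Q, of "\<lambda>F. fps_nth F j"] by simp
qed

section \<open>The equations as recurrences for the coefficients\<close>

lemma heun_eq_neg_conv_pos: "heun_eq_neg l lam \<mu> E \<longleftrightarrow> heun_eq_pos (- l) lam \<mu> E"
proof -
  have "\<mu> * (of_int l - 1) * z + lam = lam - \<mu> * (of_int (- l) + 1) * z" for z lam \<mu> :: complex
    by (simp add: algebra_simps)
  then show ?thesis by (simp only: heun_eq_neg_def heun_eq_pos_def of_int_minus)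
qed

lemma heun_coeff_rec:
  assumes F: "E has_fps_expansion F" and eq: "heun_eq_pos l lam \<mu> E"
  shows "(of_nat n * (of_nat n + of_int l) + of_real lam) * fps_nth F n
           + of_real \<mu> * (of_nat n + 1) * fps_nth F (Suc n)
         = of_real \<mu> * (of_nat n + of_int l) * (if n = 0 then 0 else fps_nth F (n - 1))"
proof -
  define G where "G = fps_X ^ 2 * fps_deriv (fps_deriv F)
      + (fps_const (of_int l + 1) * fps_X + fps_const (of_real \<mu>) * (1 - fps_X ^ 2)) * fps_deriv F
      + (fps_const (of_real lam) - fps_const (of_real \<mu> * (of_int l + 1)) * fps_X) * F"
  have "(\<lambda>z. z\<^sup>2 * deriv (deriv E) z
        + ((of_int l + 1) * z + of_real \<mu> * (1 - z\<^sup>2)) * deriv E z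
        + (of_real lam - of_real \<mu> * (of_int l + 1) * z) * E z) has_fps_expansion G"
    unfolding G_def by (intro fps_expansion_intros F)
  then have "(\<lambda>z. 0) has_fps_expansion G"
    using eq by (simp add: heun_eq_pos_def)
  then have "fps_nth G n = 0"
    by (simp add: fps_nth_fps_expansion)
  moreover have "(fps_const (of_int l + 1) * fps_X + fps_const (of_real \<mu>) * (1 - fps_X ^ 2)) * fps_deriv F
     = fps_const (of_int l + 1) * (fps_X * fps_deriv F) + fps_const (of_real \<mu>) * fps_deriv F
       - fps_const (of_real \<mu>) * (fps_X ^ 2 * fps_deriv F)"
    "(fps_const (of_real lam) - fps_const (of_real \<mu> * (of_int l + 1)) * fps_X) * F
     = fps_const (of_real lam) * F - fps_const (of_real \<mu> * (of_int l + 1)) * (fps_X * F)"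
    by (simp_all add: algebra_simps)
  moreover define f where "f = (if n = 0 then 0 else fps_nth F (n - 1))"
  have "fps_nth (fps_X ^ 2 * fps_deriv (fps_deriv F)) n = of_nat n * (of_nat n - 1) * fps_nth F n"
    "fps_nth (fps_X * fps_deriv F) n = of_nat n * fps_nth F n"
    "fps_nth (fps_X ^ 2 * fps_deriv F) n = (of_nat n - 1) * f"
    "fps_nth (fps_X * F) n = f"
    by (cases n; cases "n - 1"; simp add: fps_X_power_mult_nth f_def)+
  ultimately have "of_nat n * (of_nat n - 1) * fps_nth F n
      + ((of_int l + 1) * (of_nat n * fps_nth F n)
         + of_real \<mu> * ((of_nat n + 1) * fps_nth F (Suc n)) - of_real \<mu> * ((of_nat n - 1) * f))
      + (of_real lam * fps_nth F n - of_real \<mu> * (of_int l + 1) * f) = 0"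
    unfolding G_def by (simp add: add_ac)
  then show ?thesis
    unfolding f_def[symmetric] by algebra
qed


text \<open>
  On the level of coefficients, this is the statement that \<open>exp (x (z + 1/z)) Q(1/z)\<close> solves one
  equation if \<open>Q(-z)\<close> solves the other. The three-term recurrence for \<open>I\<close> allows the expression
  in question to be rewritten so that its coefficients depend on \<open>j\<close> only; the sum over \<open>j\<close> then
  telescopes by the recurrence for \<open>q\<close>. The boundary term at \<open>j = d\<close> vanishes because \<open>l = d + 1\<close>.
\<close>

lemma bessel_comb_rec:
  fixes q :: "nat \<Rightarrow> complex" and I :: "int \<Rightarrow> complex" and l k :: int and x lam :: complex
  assumes I: "\<And>k. of_int k * I k = x * (I (k - 1) - I (k + 1))"
    and q: "\<And>n. (of_nat n * (of_nat n - of_int l) + lam) * q n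
              = x * (of_nat n + 1) * q (Suc n) + x * (of_int l - of_nat n) * (if n = 0 then 0 else q (n - 1))"
    and l: "l = int (Suc d)" and qd: "q (Suc d) = 0"
  defines "u \<equiv> \<lambda>k. \<Sum>j\<le>d. q j * I (k + int j)"
  shows "(of_int k * (of_int k + of_int l) + lam) * u k + x * (of_int k + 1) * u (k + 1)
         = x * (of_int k + of_int l) * u (k - 1)"
proof -
  define T where "T j = q j * ((of_int k * (of_int k + of_int l) + lam) * I (k + int j)
      + x * (of_int k + 1) * I (k + int j + 1) - x * (of_int k + of_int l) * I (k + int j - 1))" for j
  have Tj: "T j = q j * ((of_nat j * (of_nat j - of_int l) + lam) * I (k + int j)
      - x * of_nat j * I (k + int j - 1) - x * (of_int l - of_nat j - 1) * I (k + int j + 1))" for j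
  proof -
    have "(of_int k + of_nat j) * I (k + int j) = x * I (k + int j - 1) - x * I (k + int j + 1)"
      using I[of "k + int j"] by (simp add: algebra_simps)
    then show ?thesis unfolding T_def by algebra
  qed
  have partial: "(\<Sum>j\<le>N. T j) = x * (of_nat N + 1) * q (Suc N) * I (k + int N)
      - x * (of_int l - of_nat N - 1) * q N * I (k + int N + 1)" for N
  proof (induction N)
    case 0
    show ?case using q[of 0] by (simp add: Tj algebra_simps)
  next
    case (Suc N)
    have "(\<Sum>j\<le>Suc N. T j) = x * (of_nat N + 1) * q (Suc N) * I (k + int N)
      - x * (of_int l - of_nat N - 1) * q N * I (k + int N + 1) + T (Suc N)"
      using Suc.IH by simp
    also have "T (Suc N) = (of_nat (Suc N) * (of_nat (Suc N) - of_int l) + lam) * q (Suc N) * I (k + int (Suc N))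
      - q (Suc N) * x * of_nat (Suc N) * I (k + int (Suc N) - 1)
      - q (Suc N) * x * (of_int l - of_nat (Suc N) - 1) * I (k + int (Suc N) + 1)"
      unfolding Tj by (simp only: algebra_simps)
    also note q[of "Suc N"]
    finally show ?case by (simp add: algebra_simps)
  qed
  have "(\<Sum>j\<le>d. T j) = (of_int k * (of_int k + of_int l) + lam) * u k + x * (of_int k + 1) * u (k + 1)
         - x * (of_int k + of_int l) * u (k - 1)"
    unfolding T_def u_def sum_distrib_left sum_subtractf[symmetric] sum.distrib[symmetric]
    by (intro sum.cong) (simp_all add: algebra_simps)
  moreover have "(\<Sum>j\<le>d. T j) = 0"
    unfolding partial by (simp add: qd l)
  ultimately show ?thesis by simp
qed

section \<open>Decaying solutions of the recurrence\<close>

text \<open>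
  The Casoratian \<open>W\<^sub>n\<close> of two solutions satisfies \<open>(n + 2) W\<^bsub>n+1\<^esub> = - (n + 1 + l) W\<^sub>n\<close>, hence it cannot
  tend to zero unless it vanishes, because \<open>l \<ge> 1\<close>. At \<open>n = 0\<close> it is a multiple of \<open>e\<^sub>0 u\<^bsub>-1\<^esub>\<close>.
\<close>

lemma decaying_solution_zero_at_minus_1:
  fixes e :: "nat \<Rightarrow> complex" and u :: "int \<Rightarrow> complex" and x lam :: complex and l :: int
  assumes e: "\<And>n. (of_nat n * (of_nat n + of_int l) + lam) * e n + x * (of_nat n + 1) * e (Suc n)
         = x * (of_nat n + of_int l) * (if n = 0 then 0 else e (n - 1))"
    and u: "\<And>k. (of_int k * (of_int k + of_int l) + lam) * u k + x * (of_int k + 1) * u (k + 1)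
         = x * (of_int k + of_int l) * u (k - 1)"
    and lim: "e \<longlonglongrightarrow> 0" "(\<lambda>n. u (int n)) \<longlonglongrightarrow> 0"
    and l: "l \<ge> 1" and x: "x \<noteq> 0" and e0: "e 0 \<noteq> 0"
  shows "u (-1) = 0"
proof -
  define W where "W n = e (Suc n) * u (int n) - e n * u (int n + 1)" for n
  have step: "(of_nat n + 2) * W (Suc n) = - (of_nat n + 1 + of_int l) * W n" for n
  proof -
    have "x * ((of_nat n + 2) * W (Suc n) + (of_nat n + 1 + of_int l) * W n) = 0"
      using e[of "Suc n"] u[of "int (Suc n)"] unfolding W_def
      by (simp add: add_ac) algebra
    then have "(of_nat n + 2) * W (Suc n) + (of_nat n + 1 + of_int l) * W n = 0"
      using x by simp
    then show ?thesis by algebra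
  qed
  have "norm (W n) \<le> norm (W (Suc n))" for n
  proof -
    have "real n + 2 \<le> real n + 1 + of_int l" using l by simp
    moreover have "(real n + 2) * norm (W (Suc n)) = (real n + 1 + of_int l) * norm (W n)"
    proof -
      have "norm (of_nat n + 2 :: complex) = real n + 2"
        "norm (of_nat n + 1 + of_int l :: complex) = real n + 1 + of_int l"
        using norm_of_nat[of "n + 2", where 'a = complex]
          norm_of_int[of "int n + 1 + l", where 'a = complex] l by (simp_all add: add_ac)
      then show ?thesis using arg_cong[OF step[of n], of norm] 
        by (simp only: norm_mult norm_minus_cancel)
    qed
    ultimately have "(real n + 2) * norm (W n) \<le> (real n + 2) * norm (W (Suc n))"
      by (simp add: mult_right_mono)
    then show ?thesis by simp
  qed
  then have mono: "norm (W 0) \<le> norm (W n)" for n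
    by (rule lift_Suc_mono_le) simp
  have "W \<longlonglongrightarrow> 0 * 0 - 0 * 0"
    unfolding W_def
  proof (intro tendsto_intros lim)
    show "(\<lambda>n. e (Suc n)) \<longlonglongrightarrow> 0" using lim(1) by (rule LIMSEQ_Suc)
    show "(\<lambda>n. u (int n + 1)) \<longlonglongrightarrow> 0" using LIMSEQ_Suc[OF lim(2)] by (simp add: add_ac)
  qed
  then have "(\<lambda>n. norm (W n)) \<longlonglongrightarrow> 0" by (simp add: tendsto_norm_zero)
  then have "norm (W 0) \<le> 0" by (rule LIMSEQ_le_const) (use mono in auto)
  then have "W 0 = 0" by simp
  moreover have "x * W 0 + e 0 * (x * of_int l * u (-1)) = 0"
    using e[of 0] u[of 0] unfolding W_def by simp algebra
  ultimately show ?thesis using x e0 l by simp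
qed

text \<open>
  In the recurrence at the index \<open>-1\<close> the factor \<open>k + 1\<close> of \<open>u\<^bsub>k+1\<^esub>\<close> is zero, so the single zero
  \<open>u\<^bsub>-1\<^esub> = 0\<close> forces the next one. Further down, the factor \<open>k + l\<close> of \<open>u\<^bsub>k-1\<^esub>\<close> does not vanish until \<open>k = -l\<close>.
\<close>

lemma zeros_propagate:
  fixes u :: "int \<Rightarrow> complex" and x lam :: complex
  assumes u: "\<And>k. (of_int k * (of_int k + of_int l) + lam) * u k + x * (of_int k + 1) * u (k + 1)
         = x * (of_int k + of_int l) * u (k - 1)"
    and x: "x \<noteq> 0" and u1: "u (-1) = 0" and "1 \<le> k" "int k \<le> l"
  shows "u (- int k) = 0"
  using \<open>1 \<le> k\<close> \<open>int k \<le> l\<close>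
proof (induction k rule: less_induct)
  case (less k)
  show ?case
  proof (cases "k = 1")
    case False
    then obtain i where i: "k = Suc i" "i \<ge> 1" using less.prems by (cases k) auto
    have ui: "u (- int i) = 0" using less.IH[of i] less.prems i by simp
    have "(of_int (- int i) + 1) * u (- int i + 1) = (0::complex)"
    proof (cases "i = 1")
      case False
      then have "u (- int (i - 1)) = 0" using less.IH[of "i - 1"] less.prems i by simp
      then show ?thesis using i by (simp add: of_nat_diff algebra_simps)
    qed simp
    then have "x * (of_int (- int i) + of_int l) * u (- int i - 1) = 0"
      using u[of "- int i"] ui by (metis add_0 mult.assoc mult_zero_right)
    moreover have "of_int (- int i) + of_int l \<noteq> (0::complex)"
      using less.prems i by (metis add.commute add_uminus_conv_diff eq_iff_diff_eq_0 of_int_add of_int_eq_0_iff of_nat_Suc not_less zle_add1_eq_le order_refl less_irrefl add1_zle_eq)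
    moreover have "- int k = - int i - 1" using i by simp
    ultimately show ?thesis using x by simp
  qed (use u1 in simp)
qed

section \<open>Polynomial solutions exclude entire ones\<close>

text \<open>
  If \<open>d\<close> is the degree, the coefficient of \<open>z\<^bsup>d+1\<^esup>\<close> in the equation is \<open>\<mu> (l - 1 - d)\<close> times the
  leading coefficient.
\<close>

lemma heun_poly_degree:
  fixes p :: "complex poly" and l :: int
  assumes "p \<noteq> 0" "\<mu> \<noteq> 0"
    and rec: "\<And>n. (of_nat n * (of_nat n - of_int l) + lam) * coeff p n + \<mu> * (of_nat n + 1) * coeff p (Suc n)
         = \<mu> * (of_nat n - of_int l) * (if n = 0 then 0 else coeff p (n - 1))"
  shows "l = int (Suc (degree p))"
proof -
  have "coeff p (Suc (degree p)) = 0" "coeff p (Suc (Suc (degree p))) = 0" "coeff p (degree p) \<noteq> 0"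
    using assms(1) by (simp_all add: coeff_eq_0)
  then have "of_nat (Suc (degree p)) - of_int l = (0::complex)"
    using rec[of "Suc (degree p)"] assms(2) by (simp del: of_nat_Suc)
  then have "of_int l = (of_int (int (Suc (degree p))) :: complex)"
    unfolding of_int_of_nat_eq by (simp only: right_minus_eq)
  then show ?thesis unfolding of_int_eq_iff .
qed

lemma poly_has_fps_expansion: "poly p has_fps_expansion fps_of_poly p"
  by (simp add: has_fps_expansion_def)

theorem theorem3p10:
  fixes l :: int and lam \<mu> :: real
  assumes "l \<ge> 1" and "\<mu> > 0"
    and "\<exists>p :: complex poly. p \<noteq> 0 \<and> heun_eq_neg l lam \<mu> (poly p)"
  shows "\<forall>E :: complex \<Rightarrow> complex.
           E holomorphic_on UNIV \<and> heun_eq_pos l lam \<mu> E \<longrightarrow> (\<forall>z. E z = 0)"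
proof (intro allI impI, elim conjE)
  fix E :: "complex \<Rightarrow> complex" and z
  assume hol: "E holomorphic_on UNIV" and pos: "heun_eq_pos l lam \<mu> E"
  obtain p :: "complex poly" where p: "p \<noteq> 0" "heun_eq_neg l lam \<mu> (poly p)"
    using assms(3) by blast
  define x where "x = complex_of_real \<mu>"
  have x: "x \<noteq> 0" using assms(2) by (simp add: x_def)
  have prec: "(of_nat n * (of_nat n - of_int l) + of_real lam) * coeff p n
      + x * (of_nat n + 1) * coeff p (Suc n)
      = x * (of_nat n - of_int l) * (if n = 0 then 0 else coeff p (n - 1))" for n
    using heun_coeff_rec[OF poly_has_fps_expansion p(2)[unfolded heun_eq_neg_conv_pos], of n]
    unfolding x_def fps_of_poly_nth of_int_minus add_uminus_conv_diff .
  define d where "d = degree p"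
  have l: "l = int (Suc d)" unfolding d_def by (rule heun_poly_degree[OF p(1) x prec])
  define q where "q j = (-1) ^ j * coeff p j" for j
  have q_above: "q j = 0" if "j > d" for j
    using that by (simp add: q_def d_def coeff_eq_0)
  have q_rec: "(of_nat n * (of_nat n - of_int l) + of_real lam) * q n
      = x * (of_nat n + 1) * q (Suc n)
        + x * (of_int l - of_nat n) * (if n = 0 then 0 else q (n - 1))" for n
  proof (cases n)
    case 0
    then show ?thesis using prec[of 0] by (simp add: q_def eq_neg_iff_add_eq_0)
  next
    case (Suc m)
    then show ?thesis
      using arg_cong[OF prec[of n], of "(*) ((-1) ^ n)"] by (simp add: q_def algebra_simps)
  qed
  define I where "I k = complex_of_real (bessel_I \<mu> k)" for k
  have I: "of_int k * I k = x * (I (k - 1) - I (k + 1))" for k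
    using arg_cong[OF bessel_I_rec[of \<mu> k], of complex_of_real] assms(2) by (simp add: I_def x_def)
  define u where "u k = (\<Sum>j\<le>d. q j * I (k + int j))" for k
  have u_rec: "(of_int k * (of_int k + of_int l) + of_real lam) * u k + x * (of_int k + 1) * u (k + 1)
         = x * (of_int k + of_int l) * u (k - 1)" for k
    unfolding u_def using I q_rec l q_above[of "Suc d"] by (intro bessel_comb_rec) auto
  have u_lim: "(\<lambda>n. u (int n)) \<longlonglongrightarrow> 0"
    unfolding u_def I_def using assms(2)
    by (intro tendsto_null_sum tendsto_mult_right_zero tendsto_of_real[where a = 0, unfolded of_real_0]
        bessel_I_tendsto_0) auto
  define F where "F = fps_expansion E 0"
  have F: "E has_fps_expansion F"
    unfolding F_def using hol by (intro has_fps_expansion_fps_expansion[of UNIV]) auto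
  note e_rec = heun_coeff_rec[OF F pos, folded x_def]
  have sums: "(\<lambda>n. fps_nth F n * z ^ n) sums E z" for z
    using hol by (intro has_fps_expansion_imp_sums_complex[OF F, of \<infinity>]) auto
  have e_lim: "fps_nth F \<longlonglongrightarrow> 0"
    using sums[of 1] by (auto simp: sums_iff dest: summable_LIMSEQ_zero)
  \<comment> \<open>The recurrence determines an entire solution by its value at the origin.\<close>
  have "fps_nth F 0 = 0"
  proof (rule ccontr)
    assume "fps_nth F 0 \<noteq> 0"
    then have "u (-1) = 0"
      using decaying_solution_zero_at_minus_1[OF e_rec u_rec e_lim u_lim] assms(1) x by blast
    then have "u (- int k) = 0" if "k \<in> {1..Suc d}" for k
      using zeros_propagate[OF u_rec x, of k] that l by auto
    then have orth: "(\<Sum>j\<le>d. q j * of_real (bessel_I \<mu> (int j - int k))) = 0" if "k \<in> {1..Suc d}" for k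
      using that unfolding u_def I_def by simp
    then have "q j = 0" for j
      using bessel_I_toeplitz_kernel_trivial[of \<mu> d q, OF assms(2) q_above orth] by simp
    then have "p = 0" by (auto simp: q_def poly_eq_iff)
    with p(1) show False by blast
  qed
  then have "fps_nth F n = 0" for n
  proof (induction n rule: less_induct)
    case (less n)
    show ?case
    proof (cases n)
      case (Suc m)
      have "x * (of_nat m + 1) * fps_nth F (Suc m) = 0"
        using e_rec[of m] less.IH[of m] less.IH[of "m - 1"] less.prems Suc by (auto split: if_splits)
      moreover have "of_nat m + 1 \<noteq> (0::complex)" by (metis of_nat_Suc of_nat_neq_0 add.commute)
      ultimately show ?thesis using x Suc by simp
    qed (use less.prems in simp)
  qed
  then show "E z = 0"
    using sums[of z] by (simp add: sums_iff)
qed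

end
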